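(* For $x>0$ define $P^*=P(e^x,e^{-x})$, $X^*=\frac{2\sinh x}{P^*}$ and $k=\frac{X^*}{2x}$, where $P$ is the Seiffert mean. Then for any $x>0$ one has $$\tanh x+x>X^*>4x-2\sinh x$$ and $$\left(\frac{\sinh x}{x}\right)^2+\frac{\tanh x}{x}>k^2-2k+3 .$$
   Context: The Seiffert mean of positive reals $a,b$ is $P(a,b)=\frac{a-b}{2\arcsin\left(\frac{a-b}{a+b}\right)}$ for $a\ne b$, and $P(a,a)=a$. *)

theory Defs
  imports Complex_Main
begin

text \<open>The Seiffert mean is meant for positive arguments only; the values elsewhere are irrelevant.\<close>

definition seiffert_mean :: "real \<Rightarrow> real \<Rightarrow> real" where
  "seiffert_mean a b =
     (if a = b then a else (a - b) / (2 * arcsin ((a - b) / (a + b))))"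

definition P_star :: "real \<Rightarrow> real" where
  "P_star x = seiffert_mean (exp x) (exp (- x))"

definition X_star :: "real \<Rightarrow> real" where
  "X_star x = 2 * sinh x / P_star x"

definition k_ratio :: "real \<Rightarrow> real" where
  "k_ratio x = X_star x / (2 * x)"

end

theory Submission imports Defs begin

text \<open>Since \<open>P\<^sup>* = sinh x / gd x\<close> with \<open>gd x = arcsin (tanh x)\<close>, we have \<open>X\<^sup>* = 2 gd x\<close> and
  \<open>k = gd x / x\<close>, where \<open>gd' = 1 / cosh\<close>. The two bounds on \<open>X\<^sup>*\<close> follow by differentiating: the
  derivatives of the differences are \<open>(1 - 1 / cosh x)\<^sup>2\<close> and \<open>2 (cosh x + 1 / cosh x - 2)\<close>.
  The last inequality reads \<open>sinh\<^sup>2 x + x tanh x > (x - gd x)\<^sup>2 + 2 x\<^sup>2\<close>. As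
  \<open>0 < x - gd x < sinh x - x\<close>, it reduces to \<open>2 sinh x + tanh x > 3 x\<close>, whose
  differentiated form is \<open>(cosh x - 1)\<^sup>2 (2 cosh x + 1) > 0\<close>.\<close>

text \<open>The Gudermannian function.\<close>

definition gd :: "real \<Rightarrow> real" where
  "gd x = arcsin (tanh x)"

lemma gd_0 [simp]: "gd 0 = 0"
  by (simp add: gd_def)

lemma one_minus_tanh_square: "1 - (tanh x)\<^sup>2 = 1 / (cosh x)\<^sup>2" for x :: real
proof -
  have "1 - (tanh x)\<^sup>2 = ((cosh x)\<^sup>2 - (sinh x)\<^sup>2) / (cosh x)\<^sup>2"
    by (simp add: tanh_def power_divide diff_divide_distrib)
  then show ?thesis
    by (simp add: hyperbolic_pythagoras)
qed

lemma has_real_derivative_tanh_cosh: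
  "(tanh has_real_derivative 1 / (cosh x)\<^sup>2) (at x)" for x :: real
  by (auto intro!: derivative_eq_intros simp: one_minus_tanh_square)

lemma has_real_derivative_gd: "(gd has_real_derivative 1 / cosh x) (at x)"
proof -
  have "((\<lambda>x. arcsin (tanh x)) has_real_derivative
      inverse (sqrt (1 - (tanh x)\<^sup>2)) * (1 / (cosh x)\<^sup>2)) (at x)"
    by (rule DERIV_chain2[OF DERIV_arcsin has_real_derivative_tanh_cosh])
      (auto simp: tanh_real_gt_neg1 tanh_real_lt_1)
  \<comment> \<open>The root equals \<open>1 / cosh x\<close> because \<open>cosh x > 0\<close>, so
    its inverse cancels one factor.\<close>
  moreover have "inverse (sqrt (1 - (tanh x)\<^sup>2)) * (1 / (cosh x)\<^sup>2) = 1 / cosh x"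
    unfolding one_minus_tanh_square by (simp add: real_sqrt_divide power2_eq_square)
  ultimately show ?thesis
    by (simp add: gd_def[abs_def])
qed

lemma X_star_eq_gd:
  assumes "x > 0"
  shows "X_star x = 2 * gd x"
proof -
  have "(exp x - exp (- x)) / (exp x + exp (- x)) = tanh x"
    by (simp add: tanh_altdef)
  moreover have "exp x - exp (- x) = 2 * sinh x"
    by (simp add: sinh_field_def)
  ultimately have "P_star x = sinh x / gd x"
    using assms by (simp add: P_star_def seiffert_mean_def gd_def)
  \<comment> \<open>Only \<open>sinh x\<close> is cancelled; were \<open>gd x = 0\<close>, both
    sides would be \<open>0\<close> by \<open>y / 0 = 0\<close>.\<close>
  moreover have "sinh x > 0"
    using assms by simp
  ultimately show ?thesis
    by (simp add: X_star_def)
qed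

text \<open>Positivity of \<open>f'\<close> is asked for \<open>y > 0\<close> only, as all
  derivatives it is applied to vanish at \<open>0\<close>.\<close>

lemma pos_of_deriv_pos:
  fixes f f' :: "real \<Rightarrow> real"
  assumes "x > 0" "f 0 = 0"
    and deriv: "\<And>y. (f has_real_derivative f' y) (at y)"
    and pos: "\<And>y. y > 0 \<Longrightarrow> f' y > 0"
  shows "f x > 0"
proof -
  have "f 0 < f x"
  proof (rule DERIV_pos_imp_increasing_open[OF \<open>x > 0\<close>])
    show "\<exists>z. (f has_real_derivative z) (at y) \<and> 0 < z" if "0 < y" for y
      using deriv pos[OF that] by blast
    show "continuous_on {0..x} f"
      using deriv by (intro continuous_at_imp_continuous_on ballI DERIV_isCont)
  qed
  with \<open>f 0 = 0\<close> show ?thesis by simp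
qed

lemma cosh_real_gt_1: "cosh x > 1" if "x > 0" for x :: real
  using cosh_real_strict_mono[of 0 x] that by simp

context
  fixes x :: real
  assumes x: "x > 0"
begin

lemma gd_less: "gd x < x"
proof -
  have "x - gd x > 0"
    by (rule pos_of_deriv_pos[OF x, where f' = "\<lambda>y. 1 - 1 / cosh y"])
      (auto intro!: derivative_eq_intros has_real_derivative_gd dest: cosh_real_gt_1)
  then show ?thesis by simp
qed

lemma two_gd_less: "2 * gd x < tanh x + x"
proof -
  have "tanh x + x - 2 * gd x > 0"
  proof (rule pos_of_deriv_pos[OF x, where f' = "\<lambda>y. (1 - 1 / cosh y)\<^sup>2"])
    show "((\<lambda>y. tanh y + y - 2 * gd y) has_real_derivative (1 - 1 / cosh y)\<^sup>2) (at y)" for y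
      by (rule derivative_eq_intros has_real_derivative_tanh_cosh has_real_derivative_gd refl)+
        (simp add: power2_eq_square field_simps)
    show "(1 - 1 / cosh y)\<^sup>2 > 0" if "y > 0" for y :: real
      using cosh_real_gt_1[OF that] by (intro zero_less_power) simp
  qed simp
  then show ?thesis by simp
qed

text \<open>Used twice: doubled, it is the lower bound on \<open>X_star x\<close>; rearranged, it
  bounds \<open>x - gd x\<close> by \<open>sinh x - x\<close>.\<close>

lemma gd_plus_sinh_greater: "gd x + sinh x > 2 * x"
proof -
  have "gd x + sinh x - 2 * x > 0"
  proof (rule pos_of_deriv_pos[OF x, where f' = "\<lambda>y. (cosh y - 1)\<^sup>2 / cosh y"])
    show "((\<lambda>y. gd y + sinh y - 2 * y) has_real_derivative (cosh y - 1)\<^sup>2 / cosh y) (at y)" for y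
      by (rule derivative_eq_intros has_real_derivative_gd refl)+
        (simp add: power2_eq_square field_simps)
    show "(cosh y - 1)\<^sup>2 / cosh y > 0" if "y > 0" for y :: real
      using cosh_real_gt_1[OF that] by (intro divide_pos_pos) auto
  qed simp
  then show ?thesis by simp
qed

lemma two_sinh_plus_tanh_greater: "2 * sinh x + tanh x > 3 * x"
proof -
  have "2 * sinh x + tanh x - 3 * x > 0"
  \<comment> \<open>With \<open>c = cosh y\<close> the derivative is
    \<open>2 * c - 3 + 1 / c^2\<close>; its numerator \<open>2 * c^3 - 3 * c^2 + 1\<close> has a
    double root at \<open>c = 1\<close>.\<close>
  proof (rule pos_of_deriv_pos[OF x,
        where f' = "\<lambda>y. (cosh y - 1)\<^sup>2 * (2 * cosh y + 1) / (cosh y)\<^sup>2"])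
    show "((\<lambda>y. 2 * sinh y + tanh y - 3 * y) has_real_derivative
        (cosh y - 1)\<^sup>2 * (2 * cosh y + 1) / (cosh y)\<^sup>2) (at y)" for y :: real
      by (rule derivative_eq_intros has_real_derivative_tanh_cosh refl)+
        (simp add: power2_eq_square field_simps)
    show "(cosh y - 1)\<^sup>2 * (2 * cosh y + 1) / (cosh y)\<^sup>2 > 0" if "y > 0" for y :: real
      using cosh_real_gt_1[OF that] by (intro divide_pos_pos mult_pos_pos) auto
  qed simp
  then show ?thesis by simp
qed

lemma sinh_square_plus_greater: "(sinh x)\<^sup>2 + x * tanh x > (x - gd x)\<^sup>2 + 2 * x\<^sup>2"
proof -
  have "(x - gd x)\<^sup>2 < (sinh x - x)\<^sup>2"
    using gd_less gd_plus_sinh_greater by (intro power_strict_mono) auto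
  \<comment> \<open>Expanding \<open>(sinh x - x)\<^sup>2\<close> cancels
    \<open>(sinh x)\<^sup>2\<close> and leaves exactly this to show.\<close>
  moreover have "x * (2 * sinh x + tanh x) > x * (3 * x)"
    using two_sinh_plus_tanh_greater x by (intro mult_strict_left_mono)
  ultimately show ?thesis
    by (simp add: power2_eq_square algebra_simps)
qed

end

theorem theorem3p1:
  fixes x :: real
  assumes "x > 0"
  shows "tanh x + x > X_star x \<and> X_star x > 4 * x - 2 * sinh x \<and>
    (sinh x / x)\<^sup>2 + tanh x / x > (k_ratio x)\<^sup>2 - 2 * k_ratio x + 3"
proof (intro conjI)
  show "tanh x + x > X_star x"
    using two_gd_less[OF assms] by (simp add: X_star_eq_gd assms)
  show "X_star x > 4 * x - 2 * sinh x"
    using gd_plus_sinh_greater[OF assms] by (simp add: X_star_eq_gd assms)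
  have "k_ratio x = gd x / x"
    by (simp add: k_ratio_def X_star_eq_gd assms)
  \<comment> \<open>Completing the square:
    \<open>k\<^sup>2 - 2 * k + 3 = (1 - k)\<^sup>2 + 2\<close> with
    \<open>k = gd x / x\<close>.\<close>
  moreover have "(gd x / x)\<^sup>2 - 2 * (gd x / x) + 3 = ((x - gd x)\<^sup>2 + 2 * x\<^sup>2) / x\<^sup>2"
    using assms by (simp add: power2_eq_square field_simps)
  ultimately have "(k_ratio x)\<^sup>2 - 2 * k_ratio x + 3 = ((x - gd x)\<^sup>2 + 2 * x\<^sup>2) / x\<^sup>2"
    by simp
  also have "\<dots> < ((sinh x)\<^sup>2 + x * tanh x) / x\<^sup>2"
    using sinh_square_plus_greater[OF assms] assms by (intro divide_strict_right_mono) auto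
  also have "\<dots> = (sinh x / x)\<^sup>2 + tanh x / x"
    using assms by (simp add: power2_eq_square field_simps)
  finally show "(sinh x / x)\<^sup>2 + tanh x / x > (k_ratio x)\<^sup>2 - 2 * k_ratio x + 3" .
qed

end
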